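(* Let $\gamma\in(0,2)$, $\theta\in\mathbb R$, $\kappa>0$, $\alpha,\beta\in(0,1)$, and let $\rho:[0,1]\to(0,1)$ be such that $\rho(0)=\alpha$ and $\rho(1)=\beta$. Fix a positive integer $\ell_0\le N-1$ and define $\ell_i:=2^i\ell_0$ for $i\in\{1,\dots,M\}$, where $M$ is a positive integer such that $\ell_M<N-1$. Let $f$ be a density with respect to $\nu^N_{\rho(\cdot)}$ on $\Omega_N$. Then $$\sum_{i=1}^M\sum_{y=1}^{\ell_{i-1}}\frac{I_{y,y+\ell_{i-1}}\big(\sqrt f,\nu^N_{\rho(\cdot)}\big)}{\ell_{i-1}^\gamma}\lesssim D_N\big(\sqrt f,\nu^N_{\rho(\cdot)}\big),$$ where $\lesssim$ means that the left-hand side is at most $C$ times the right-hand side, for a constant $C>0$ independent of $N$, $\ell_0$, $M$ and $f$.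
   Context: Let $c_\gamma=\big(\sum_{z\in\mathbb Z\setminus\{0\}}|z|^{-\gamma-1}\big)^{-1}$, $p(z)=c_\gamma|z|^{-\gamma-1}$ for $z\in\mathbb Z\setminus\{0\}$, $p(0)=0$; for $N\ge2$, $\Lambda_N=\{1,\dots,N-1\}$, $\Omega_N=\{0,1\}^{\Lambda_N}$. $\nu^N_{\rho(\cdot)}$ is the product Bernoulli measure on $\Omega_N$ with $\nu^N_{\rho(\cdot)}\{\eta(x)=1\}=\rho(x/N)$. A density with respect to $\mu$ is $f:\Omega_N\to[0,\infty)$ with $\int f\,d\mu=1$. $\sigma^{x,y}\eta$ is $\eta$ with the values at $x$ and $y$ exchanged, $\sigma^x\eta$ is $\eta$ with $\eta(x)$ replaced by $1-\eta(x)$, and $c_x(\eta;\delta)=\eta(x)(1-\delta)+(1-\eta(x))\delta$. Define $$I_{x,y}(\sqrt f,\mu)=\int\big(\sqrt{f(\sigma^{x,y}\eta)}-\sqrt{f(\eta)}\big)^2d\mu,\qquad I^\delta_x(\sqrt f,\mu)=\int c_x(\eta;\delta)\big(\sqrt{f(\sigma^x\eta)}-\sqrt{f(\eta)}\big)^2d\mu,$$ $$D_N(\sqrt f,\mu)=\tfrac12\sum_{x,y\in\Lambda_N}p(y-x)I_{x,y}(\sqrt f,\mu)+\tfrac{\kappa}{N^\theta}\sum_{x\in\Lambda_N}\sum_{y\le0}p(y-x)I^\alpha_x(\sqrt f,\mu)+\tfrac{\kappa}{N^\theta}\sum_{x\in\Lambda_N}\sum_{y\ge N}p(y-x)I^\beta_x(\sqrt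 f,\mu),$$ with $y\in\mathbb Z$ in the last two sums.
   Formalization: The profile ρ is additionally assumed bounded away from 0 and 1 on [0,1] (some ε>0 with ε ≤ ρ ≤ 1−ε), which is automatic for continuous ρ; for arbitrary ρ:[0,1]→(0,1) the bound with C independent of N is false. *)

theory Defs
  imports "HOL-Probability.Probability"
begin

text \<open>
  A configuration on \<open>\<Lambda>\<^sub>N\<close> is encoded as a total function on the integers, \<open>True\<close> meaning an
  occupied site, with the value \<open>False\<close> at every site outside \<open>\<Lambda>\<^sub>N\<close>.
\<close>

type_synonym config = "int \<Rightarrow> bool"

definition sites :: "nat \<Rightarrow> int set" where
  "sites N = {1..int N - 1}"

definition configs :: "nat \<Rightarrow> config set" where
  "configs N = PiE_dflt (sites N) False (\<lambda>_. UNIV)"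

definition c_norm :: "real \<Rightarrow> real" where
  "c_norm \<gamma> = inverse (\<Sum>\<^sub>\<infinity>z\<in>UNIV - {0::int}. real_of_int \<bar>z\<bar> powr (- \<gamma> - 1))"

definition jump :: "real \<Rightarrow> int \<Rightarrow> real" where
  "jump \<gamma> z = (if z = 0 then 0 else c_norm \<gamma> * real_of_int \<bar>z\<bar> powr (- \<gamma> - 1))"

definition bernoulli_product :: "nat \<Rightarrow> (real \<Rightarrow> real) \<Rightarrow> config pmf" where
  "bernoulli_product N \<rho> =
     Pi_pmf (sites N) False (\<lambda>x. bernoulli_pmf (\<rho> (real_of_int x / real N)))"

definition is_density :: "nat \<Rightarrow> config pmf \<Rightarrow> (config \<Rightarrow> real) \<Rightarrow> bool" where
  "is_density N \<mu> f \<longleftrightarrow> (\<forall>\<eta>\<in>configs N. 0 \<le> f \<eta>) \<and> measure_pmf.expectation \<mu> f = 1"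

definition exchange :: "int \<Rightarrow> int \<Rightarrow> config \<Rightarrow> config" where
  "exchange x y \<eta> = \<eta>(x := \<eta> y, y := \<eta> x)"

definition flip :: "int \<Rightarrow> config \<Rightarrow> config" where
  "flip x \<eta> = \<eta>(x := \<not> \<eta> x)"

definition flip_rate :: "int \<Rightarrow> config \<Rightarrow> real \<Rightarrow> real" where
  "flip_rate x \<eta> \<delta> = of_bool (\<eta> x) * (1 - \<delta>) + (1 - of_bool (\<eta> x)) * \<delta>"

text \<open>In the functionals below \<open>g\<close> plays the role of the square root of a density.\<close>

definition I_exchange :: "int \<Rightarrow> int \<Rightarrow> (config \<Rightarrow> real) \<Rightarrow> config pmf \<Rightarrow> real" where
  "I_exchange x y g \<mu> = measure_pmf.expectation \<mu> (\<lambda>\<eta>. (g (exchange x y \<eta>) - g \<eta>)\<^sup>2)"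

definition I_flip :: "real \<Rightarrow> int \<Rightarrow> (config \<Rightarrow> real) \<Rightarrow> config pmf \<Rightarrow> real" where
  "I_flip \<delta> x g \<mu> =
     measure_pmf.expectation \<mu> (\<lambda>\<eta>. flip_rate x \<eta> \<delta> * (g (flip x \<eta>) - g \<eta>)\<^sup>2)"

definition dirichlet ::
  "real \<Rightarrow> real \<Rightarrow> real \<Rightarrow> real \<Rightarrow> real \<Rightarrow> nat \<Rightarrow> (config \<Rightarrow> real) \<Rightarrow> config pmf \<Rightarrow> real" where
  "dirichlet \<gamma> \<theta> \<kappa> \<alpha> \<beta> N g \<mu> =
     1 / 2 * (\<Sum>x\<in>sites N. \<Sum>y\<in>sites N. jump \<gamma> (y - x) * I_exchange x y g \<mu>)
     + \<kappa> / real N powr \<theta> *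
         (\<Sum>x\<in>sites N. \<Sum>\<^sub>\<infinity>y\<in>{..0}. jump \<gamma> (y - x) * I_flip \<alpha> x g \<mu>)
     + \<kappa> / real N powr \<theta> *
         (\<Sum>x\<in>sites N. \<Sum>\<^sub>\<infinity>y\<in>{int N..}. jump \<gamma> (y - x) * I_flip \<beta> x g \<mu>)"

definition dyadic :: "nat \<Rightarrow> nat \<Rightarrow> nat" where
  "dyadic l0 i = 2 ^ i * l0"

end

theory Submission
  imports Defs
begin

text \<open>
  Fix a scale \<open>L = l\<^bsub>i-1\<^esub>\<close>. An exchange of \<open>y\<close> and \<open>y + L\<close> is a composition of exchanges along
  \<open>y, z\<close> and \<open>z, y + L\<close>, for every \<open>z\<close> in the block \<open>(L, 2L]\<close>; since the density of the measure
  changes under an exchange by a bounded factor only, \<open>I\<^bsub>y,y+L\<^esub>\<close> is bounded by a constant times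
  \<open>I\<^bsub>y,z\<^esub> + I\<^bsub>z,y+L\<^esub>\<close>. Averaging over the \<open>L\<close> choices of \<open>z\<close> turns \<open>L powr (-\<gamma>)\<close> into
  \<open>L powr (-\<gamma> - 1)\<close>, which is at most a constant times the jump rate. As the dyadic blocks
  \<open>(L, 2L]\<close> are disjoint, no bond is used at more than one scale, so that summing over the scales
  costs nothing.
\<close>

section \<open>The jump rate: normalising constant and lower bound\<close>

lemma summable_on_int_powr:
  fixes s :: real
  assumes "s < -1"
  shows "(\<lambda>z::int. real_of_int \<bar>z\<bar> powr s) summable_on (UNIV - {0})"
proof -
  have nat: "(\<lambda>n. real n powr s) summable_on UNIV"
    using assms by (intro summable_nonneg_imp_summable_on) (auto simp: summable_real_powr_iff)
  have "(\<lambda>z::int. real_of_int \<bar>z\<bar> powr s) summable_on range int"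
    by (subst summable_on_reindex) (auto simp: o_def nat)
  moreover have "(\<lambda>z::int. real_of_int \<bar>z\<bar> powr s) summable_on range (\<lambda>n. - int n)"
    by (subst summable_on_reindex) (auto simp: o_def nat inj_on_def)
  ultimately have "(\<lambda>z::int. real_of_int \<bar>z\<bar> powr s)
      summable_on (range int \<union> range (\<lambda>n. - int n))"
    by (rule summable_on_union)
  moreover have "z \<in> range int \<union> range (\<lambda>n. - int n)" for z
    by (cases z rule: int_cases2) auto
  ultimately show ?thesis
    by (meson subsetI summable_on_subset_banach)
qed

lemma c_norm_pos:
  assumes "0 < \<gamma>"
  shows "0 < c_norm \<gamma>"
proof -
  let ?h = "\<lambda>z::int. real_of_int \<bar>z\<bar> powr (- \<gamma> - 1)"
  \<comment> \<open>The term at 1 equals 1, so the whole sum is at least 1. Summability is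
    essential: a divergent \<open>infsum\<close> is 0 by default, which would make
    \<open>c_norm \<gamma>\<close> zero.\<close>
  have "(\<Sum>z\<in>{1::int}. ?h z) \<le> (\<Sum>\<^sub>\<infinity>z\<in>UNIV - {0}. ?h z)"
    using assms by (intro finite_sum_le_infsum summable_on_int_powr) auto
  then show ?thesis
    by (simp add: c_norm_def)
qed

lemma jump_nonneg: "0 < \<gamma> \<Longrightarrow> 0 \<le> jump \<gamma> z"
  using c_norm_pos[of \<gamma>] by (simp add: jump_def)

text \<open>The exponent is negative, so the power at \<open>\<bar>z\<bar>\<close> is at least the
  power at \<open>2 * L\<close>; extracting the 2 costs \<open>2 powr (\<gamma> + 1)\<close>, and
  \<open>c_norm \<gamma>\<close> undoes the normalisation.\<close>

lemma jump_ge: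
  assumes "0 < \<gamma>" "z \<noteq> 0" "real_of_int \<bar>z\<bar> \<le> 2 * L"
  shows "L powr (- \<gamma> - 1) \<le> 2 powr (\<gamma> + 1) / c_norm \<gamma> * jump \<gamma> z"
proof -
  have L: "0 < L" using assms by linarith
  have "L powr (- \<gamma> - 1) = 2 powr (\<gamma> + 1) * (2 * L) powr (- \<gamma> - 1)"
    using L powr_add[of 2 "\<gamma> + 1" "- \<gamma> - 1"] by (simp add: powr_mult)
  also have "\<dots> \<le> 2 powr (\<gamma> + 1) * real_of_int \<bar>z\<bar> powr (- \<gamma> - 1)"
    using assms by (intro mult_left_mono powr_mono2') auto
  also have "\<dots> = 2 powr (\<gamma> + 1) / c_norm \<gamma> * jump \<gamma> z"
    using assms c_norm_pos[of \<gamma>] by (simp add: jump_def)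
  finally show ?thesis .
qed

section \<open>The Bernoulli product measure on the finite configuration space\<close>

lemma finite_configs: "finite (configs N)"
  by (simp add: configs_def sites_def finite_PiE_dflt)

lemma set_bernoulli_product: "set_pmf (bernoulli_product N \<rho>) \<subseteq> configs N"
proof -
  have "PiE_dflt (sites N) False (\<lambda>x. set_pmf (bernoulli_pmf (\<rho> (real_of_int x / real N))))
      \<subseteq> configs N"
    unfolding configs_def PiE_dflt_def by auto
  then show ?thesis
    unfolding bernoulli_product_def by (simp add: set_Pi_pmf sites_def o_def)
qed

text \<open>With integrals written as finite sums, comparing them raises no question of
  integrability.\<close>

lemma expectation_bernoulli_product:
  fixes h :: "config \<Rightarrow> real"
  shows "measure_pmf.expectation (bernoulli_product N \<rho>) h
    = (\<Sum>\<eta>\<in>configs N. pmf (bernoulli_product N \<rho>) \<eta> * h \<eta>)"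
  using set_bernoulli_product[of N \<rho>]
  by (subst integral_measure_pmf[OF finite_configs[of N]]) auto

section \<open>Exchanges of two sites and the change of measure they cause\<close>

lemma exchange_exchange: "exchange x y (exchange x y \<eta>) = \<eta>"
  by (auto simp: exchange_def fun_eq_iff)

lemma exchange_self: "exchange x x \<eta> = \<eta>"
  by (auto simp: exchange_def fun_eq_iff)

lemma exchange_commute: "exchange x y = exchange y x"
  by (auto simp: exchange_def fun_eq_iff)

text \<open>This is conjugation of transpositions, \<open>(x z) = (x y)(y z)(x y)\<close>.\<close>

lemma exchange_conj:
  assumes "x \<noteq> y" "x \<noteq> z" "y \<noteq> z"
  shows "exchange x z \<eta> = exchange x y (exchange y z (exchange x y \<eta>))"
  using assms by (auto simp: exchange_def fun_eq_iff)

lemma exchange_configs: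
  assumes "x \<in> sites N" "y \<in> sites N"
  shows "exchange x y \<eta> \<in> configs N \<longleftrightarrow> \<eta> \<in> configs N"
proof -
  have "exchange x y \<xi> \<in> configs N" if "\<xi> \<in> configs N" for \<xi>
    using assms that by (auto simp: configs_def PiE_dflt_def exchange_def)
  from this[of \<eta>] this[of "exchange x y \<eta>"] show ?thesis
    by (auto simp: exchange_exchange)
qed

text \<open>An exchange alters only the factors at \<open>x\<close> and \<open>y\<close> of the
  product weight. Each factor lies between \<epsilon> and 1, so the product of the two lies between
  \<open>\<epsilon>\<^sup>2\<close> and 1 before and after.\<close>

lemma pmf_exchange_le:
  assumes "0 < \<epsilon>" and \<rho>: "\<forall>u\<in>{0..1}. \<epsilon> \<le> \<rho> u \<and> \<rho> u \<le> 1 - \<epsilon>"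
    and x: "x \<in> sites N" and y: "y \<in> sites N"
  shows "\<epsilon>\<^sup>2 * pmf (bernoulli_product N \<rho>) (exchange x y \<eta>) \<le> pmf (bernoulli_product N \<rho>) \<eta>"
proof (cases "x = y \<or> \<eta> \<notin> configs N")
  case True
  \<comment> \<open>If \<open>x = y\<close>, two separate factors cannot be split off, but the
    exchange is the identity and \<open>\<epsilon>\<^sup>2 \<le> 1\<close> suffices. Outside
    \<open>configs N\<close> both weights vanish.\<close>
  have "\<epsilon> \<le> 1" using \<rho> assms(1) by (auto dest: bspec[of _ _ 0])
  then have "\<epsilon>\<^sup>2 \<le> 1" using assms(1) by (simp add: power_le_one)
  moreover have "pmf (bernoulli_product N \<rho>) \<xi> = 0" if "\<xi> \<notin> configs N" for \<xi>
    using that set_bernoulli_product[of N \<rho>] by (auto simp: pmf_eq_0_set_pmf)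
  ultimately show ?thesis
    using True exchange_configs[OF x y, of \<eta>] by (auto simp: exchange_self mult_left_le_one_le)
next
  case False
  define b where "b v = pmf (bernoulli_pmf (\<rho> (real_of_int v / real N)))" for v
  define R where "R \<xi> = (\<Prod>v\<in>sites N - {x, y}. b v (\<xi> v))" for \<xi> :: config
  have pmf: "pmf (bernoulli_product N \<rho>) \<xi> = b x (\<xi> x) * b y (\<xi> y) * R \<xi>"
    if "\<xi> \<in> configs N" for \<xi>
  proof -
    have "pmf (bernoulli_product N \<rho>) \<xi> = (\<Prod>v\<in>sites N. b v (\<xi> v))"
      using that unfolding bernoulli_product_def b_def
      by (subst pmf_Pi') (auto simp: sites_def configs_def PiE_dflt_def)
    also have "sites N = insert x (insert y (sites N - {x, y}))"
      using x y by auto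
    also have "(\<Prod>v\<in>\<dots>. b v (\<xi> v)) = b x (\<xi> x) * b y (\<xi> y) * R \<xi>"
      using False by (simp add: R_def sites_def)
    finally show ?thesis .
  qed
  have b: "\<epsilon> \<le> b v t" if "v \<in> sites N" for v t
  proof -
    have "real_of_int v / real N \<in> {0..1}"
      using that by (auto simp: sites_def divide_simps)
    from bspec[OF \<rho> this] assms(1) show ?thesis
      by (cases t) (auto simp: b_def)
  qed
  have R: "0 \<le> R \<eta>" "R (exchange x y \<eta>) = R \<eta>"
    unfolding R_def by (auto simp: b_def exchange_def intro!: prod_nonneg prod.cong)
  have "\<epsilon>\<^sup>2 * pmf (bernoulli_product N \<rho>) (exchange x y \<eta>)
      = \<epsilon>\<^sup>2 * (b x (exchange x y \<eta> x) * b y (exchange x y \<eta> y)) * R \<eta>"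
    using False by (simp add: pmf exchange_configs x y R)
  also have "\<dots> \<le> \<epsilon>\<^sup>2 * 1 * R \<eta>"
    by (intro mult_right_mono mult_left_mono mult_le_one R) (auto simp: b_def pmf_le_1)
  also have "\<dots> \<le> b x (\<eta> x) * b y (\<eta> y) * R \<eta>"
    unfolding power2_eq_square using assms(1) b[OF x, of "\<eta> x"] b[OF y, of "\<eta> y"]
    by (simp add: R mult_mono mult_right_mono)
  also have "\<dots> = pmf (bernoulli_product N \<rho>) \<eta>"
    using False by (simp add: pmf)
  finally show ?thesis .
qed

text \<open>Reindexing by the involution \<open>exchange x y\<close> moves the exchange from
  \<open>h\<close> onto the weight, where \<open>pmf_exchange_le\<close> applies.\<close>

lemma expectation_exchange_le:
  fixes h :: "config \<Rightarrow> real"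
  assumes \<epsilon>: "0 < \<epsilon>" and \<rho>: "\<forall>u\<in>{0..1}. \<epsilon> \<le> \<rho> u \<and> \<rho> u \<le> 1 - \<epsilon>"
    and x: "x \<in> sites N" and y: "y \<in> sites N" and h: "\<And>\<eta>. 0 \<le> h \<eta>"
  shows "measure_pmf.expectation (bernoulli_product N \<rho>) (\<lambda>\<eta>. h (exchange x y \<eta>))
    \<le> 1 / \<epsilon>\<^sup>2 * measure_pmf.expectation (bernoulli_product N \<rho>) h"
proof -
  let ?p = "pmf (bernoulli_product N \<rho>)"
  have "(\<Sum>\<eta>\<in>configs N. ?p \<eta> * h (exchange x y \<eta>))
      = (\<Sum>\<eta>\<in>configs N. ?p (exchange x y \<eta>) * h \<eta>)"
    by (rule sum.reindex_bij_witness[of _ "exchange x y" "exchange x y"])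
       (auto simp: exchange_exchange exchange_configs x y)
  also have "\<dots> \<le> (\<Sum>\<eta>\<in>configs N. 1 / \<epsilon>\<^sup>2 * (?p \<eta> * h \<eta>))"
  proof (rule sum_mono)
    fix \<eta>
    have "?p (exchange x y \<eta>) \<le> 1 / \<epsilon>\<^sup>2 * ?p \<eta>"
      using pmf_exchange_le[OF \<epsilon> \<rho> x y, of \<eta>] \<epsilon> by (simp add: pos_le_divide_eq mult.commute)
    from mult_right_mono[OF this h[of \<eta>]]
    show "?p (exchange x y \<eta>) * h \<eta> \<le> 1 / \<epsilon>\<^sup>2 * (?p \<eta> * h \<eta>)"
      by (simp only: mult.assoc)
  qed
  finally show ?thesis
    by (simp add: expectation_bernoulli_product sum_distrib_left)
qed

section \<open>The exchange functional and its triangle inequality\<close>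

lemma I_exchange_nonneg: "0 \<le> I_exchange x y g \<mu>"
  unfolding I_exchange_def by (intro integral_nonneg_AE) auto

lemma I_exchange_self: "I_exchange x x g \<mu> = 0"
  by (simp add: I_exchange_def exchange_self)

lemma I_exchange_commute: "I_exchange x y g \<mu> = I_exchange y x g \<mu>"
  by (simp add: I_exchange_def exchange_commute)

text \<open>Along the path of \<open>exchange_conj\<close> the increment of \<open>g\<close>
  telescopes into three. Squaring costs a factor 3, and each exchange already performed before an
  increment costs a factor \<open>K\<close> when it is removed by a change of variables. The bond
  \<open>x, y\<close> is used first and last, giving \<open>K\<^sup>2 + 1\<close>, the bond
  \<open>y, z\<close> once, giving \<open>K\<close>; as \<open>1 \<le> K\<close>, the total is at
  most \<open>6 * K\<^sup>2\<close>, which \<open>9 * K\<^sup>2\<close> covers.\<close>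

lemma I_exchange_triangle:
  assumes \<epsilon>: "0 < \<epsilon>" and \<rho>: "\<forall>u\<in>{0..1}. \<epsilon> \<le> \<rho> u \<and> \<rho> u \<le> 1 - \<epsilon>"
    and x: "x \<in> sites N" and y: "y \<in> sites N" and z: "z \<in> sites N"
    and K: "K = 1 / \<epsilon>\<^sup>2"
  shows "I_exchange x z g (bernoulli_product N \<rho>)
    \<le> 9 * K\<^sup>2 * (I_exchange x y g (bernoulli_product N \<rho>) + I_exchange y z g (bernoulli_product N \<rho>))"
proof -
  let ?\<mu> = "bernoulli_product N \<rho>"
  let ?E = "measure_pmf.expectation ?\<mu>"
  let ?I = "\<lambda>x y. I_exchange x y g ?\<mu>"
  have "\<epsilon> \<le> 1" using \<rho> \<epsilon> by (auto dest: bspec[of _ _ 0])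
  then have K1: "1 \<le> K" using \<epsilon> K by (simp add: power_le_one)
  then have K2: "1 \<le> K\<^sup>2" "K \<le> K\<^sup>2" by (simp_all add: self_le_power)
  note nn = I_exchange_nonneg[of _ _ g ?\<mu>]
  show ?thesis
  proof (cases "x = y \<or> y = z \<or> x = z")
    case True
    then have "?I x z \<le> 1 * (?I x y + ?I y z)"
      using nn by (auto simp: I_exchange_self)
    also have "\<dots> \<le> 9 * K\<^sup>2 * (?I x y + ?I y z)"
      using K2 nn by (intro mult_right_mono add_nonneg_nonneg) auto
    finally show ?thesis .
  next
    case False
    define a where "a \<eta> = (g (exchange x y \<eta>) - g \<eta>)\<^sup>2" for \<eta>
    define b where "b \<eta> = (g (exchange y z \<eta>) - g \<eta>)\<^sup>2" for \<eta>
    have I: "?I x y = ?E a" "?I y z = ?E b"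
      by (simp_all add: I_exchange_def a_def[abs_def] b_def[abs_def])
    note le = expectation_exchange_le[OF \<epsilon> \<rho>, folded K]
    \<comment> \<open>The right side minus the left is
      \<open>(u - v)\<^sup>2 + (v - w)\<^sup>2 + (u - w)\<^sup>2\<close>.\<close>
    have sq: "(u + v + w)\<^sup>2 \<le> 3 * (u\<^sup>2 + v\<^sup>2 + w\<^sup>2)" for u v w :: real
      using sum_squares_ge_zero[of "u - v" "v - w"] zero_le_power2[of "u - w"]
      by (simp add: power2_eq_square algebra_simps)
    have pt: "(g (exchange x z \<eta>) - g \<eta>)\<^sup>2
        \<le> 3 * (a (exchange y z (exchange x y \<eta>)) + b (exchange x y \<eta>) + a \<eta>)" for \<eta>
    proof -
      have "g (exchange x z \<eta>) - g \<eta>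
          = (g (exchange x y (exchange y z (exchange x y \<eta>))) - g (exchange y z (exchange x y \<eta>)))
            + (g (exchange y z (exchange x y \<eta>)) - g (exchange x y \<eta>))
            + (g (exchange x y \<eta>) - g \<eta>)"
        using False by (simp add: exchange_conj[of x y z])
      then show ?thesis
        unfolding a_def b_def by (simp only: sq)
    qed
    have "?I x z \<le> 3 * (?E (\<lambda>\<eta>. a (exchange y z (exchange x y \<eta>)))
        + ?E (\<lambda>\<eta>. b (exchange x y \<eta>)) + ?E a)"
      unfolding I_exchange_def expectation_bernoulli_product sum.distrib[symmetric]
        sum_distrib_left distrib_left[symmetric] mult.left_commute[of 3]
      by (intro sum_mono mult_left_mono pt) auto
    also have "?E (\<lambda>\<eta>. a (exchange y z (exchange x y \<eta>))) \<le> K * ?E (\<lambda>\<eta>. a (exchange y z \<eta>))"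
      by (rule le[OF x y]) (auto simp: a_def)
    also have "?E (\<lambda>\<eta>. a (exchange y z \<eta>)) \<le> K * ?E a"
      by (rule le[OF y z]) (auto simp: a_def)
    also have "?E (\<lambda>\<eta>. b (exchange x y \<eta>)) \<le> K * ?E b"
      by (rule le[OF x y]) (auto simp: b_def)
    finally have "?I x z \<le> 3 * (K * (K * ?I x y) + K * ?I y z + ?I x y)"
      using K1 by (simp add: I)
    moreover have "1 * ?I x y \<le> K\<^sup>2 * ?I x y" "K * ?I y z \<le> K\<^sup>2 * ?I y z"
        "0 \<le> K\<^sup>2 * ?I x y" "0 \<le> K\<^sup>2 * ?I y z"
      using K2 nn by (intro mult_right_mono mult_nonneg_nonneg; simp)+
    ultimately show ?thesis
      by (simp add: algebra_simps power2_eq_square)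
  qed
qed

section \<open>Comparison of sums over bonds with the Dirichlet form\<close>

lemma I_flip_nonneg: "0 < \<delta> \<Longrightarrow> \<delta> < 1 \<Longrightarrow> 0 \<le> I_flip \<delta> x g \<mu>"
  unfolding I_flip_def by (intro integral_nonneg_AE) (auto simp: flip_rate_def)

text \<open>The two boundary terms are nonnegative and are dropped; the 2 cancels the factor
  \<open>1 / 2\<close> of the bulk term.\<close>

lemma bulk_le_dirichlet:
  assumes "0 < \<gamma>" "0 < \<kappa>" "0 < \<alpha>" "\<alpha> < 1" "0 < \<beta>" "\<beta> < 1"
  shows "(\<Sum>x\<in>sites N. \<Sum>y\<in>sites N. jump \<gamma> (y - x) * I_exchange x y g \<mu>)
    \<le> 2 * dirichlet \<gamma> \<theta> \<kappa> \<alpha> \<beta> N g \<mu>"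
proof -
  have "0 \<le> \<kappa> / real N powr \<theta> *
      (\<Sum>x\<in>sites N. \<Sum>\<^sub>\<infinity>y\<in>Y. jump \<gamma> (y - x) * I_flip \<delta> x g \<mu>)"
    if "0 < \<delta>" "\<delta> < 1" for Y \<delta>
    using assms that
    by (intro mult_nonneg_nonneg sum_nonneg infsum_nonneg jump_nonneg I_flip_nonneg) auto
  from this[of \<alpha> "{..0}"] this[of \<beta> "{int N..}"] show ?thesis
    using assms unfolding dirichlet_def by simp
qed

text \<open>Disjoint second factors already make the rectangles \<open>A i \<times> B i\<close>
  disjoint. The first factors may overlap, as the nested intervals \<open>{1..L}\<close>
  will.\<close>

lemma sum_Sigma_disjoint_le:
  fixes F :: "'a \<Rightarrow> 'a \<Rightarrow> real"
  assumes "finite S" "finite I" and F: "\<And>x y. 0 \<le> F x y"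
    and sub: "\<And>i. i \<in> I \<Longrightarrow> A i \<subseteq> S" "\<And>i. i \<in> I \<Longrightarrow> B i \<subseteq> S"
    and disj: "disjoint_family_on B I"
  shows "(\<Sum>i\<in>I. \<Sum>x\<in>A i. \<Sum>y\<in>B i. F x y) \<le> (\<Sum>x\<in>S. \<Sum>y\<in>S. F x y)"
proof -
  have fin: "finite (A i)" "finite (B i)" if "i \<in> I" for i
    using sub[OF that] assms(1) by (auto intro: finite_subset)
  have "(\<Sum>i\<in>I. \<Sum>x\<in>A i. \<Sum>y\<in>B i. F x y) = (\<Sum>i\<in>I. \<Sum>(x, y)\<in>A i \<times> B i. F x y)"
    using fin by (intro sum.cong) (auto simp: sum.cartesian_product)
  also have "\<dots> = (\<Sum>(x, y)\<in>(\<Union>i\<in>I. A i \<times> B i). F x y)"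
    using assms(2) fin disj by (subst sum.UNION_disjoint) (auto simp: disjoint_family_on_def Times_Int_Times)
  also have "\<dots> \<le> (\<Sum>(x, y)\<in>S \<times> S. F x y)"
    using assms(1) sub F by (intro sum_mono2) auto
  finally show ?thesis
    by (simp add: sum.cartesian_product)
qed

section \<open>Dyadic blocks and the estimate at a single scale\<close>

lemma dyadic_Suc: "dyadic l0 (Suc i) = 2 * dyadic l0 i"
  by (simp add: dyadic_def)

lemma dyadic_mono: "i \<le> j \<Longrightarrow> dyadic l0 i \<le> dyadic l0 j"
  by (simp add: dyadic_def)

text \<open>The right end of block \<open>i\<close> is the scale \<open>dyadic l0 (Suc i)\<close>,
  and every block excludes its own scale, so consecutive blocks do not even share an
  endpoint.\<close>

lemma disjoint_dyadic_blocks: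
  "disjoint_family (\<lambda>i. {int (dyadic l0 i) + 1..2 * int (dyadic l0 i)})"
proof -
  have "{int (dyadic l0 i) + 1..2 * int (dyadic l0 i)}
      \<inter> {int (dyadic l0 j) + 1..2 * int (dyadic l0 j)} = {}" if "i < j" for i j
    using dyadic_mono[of "Suc i" j l0] that by (auto simp: dyadic_Suc)
  then show ?thesis
    unfolding disjoint_family_on_def by (metis Int_commute linorder_neqE_nat)
qed

text \<open>The term \<open>z = y + L\<close>, at which the jump rate vanishes, is harmless because
  \<open>I\<^bsub>z,z\<^esub> = 0\<close>.\<close>

lemma scale_le:
  assumes \<gamma>: "0 < \<gamma>" and \<epsilon>: "0 < \<epsilon>"
    and \<rho>: "\<forall>u\<in>{0..1}. \<epsilon> \<le> \<rho> u \<and> \<rho> u \<le> 1 - \<epsilon>"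
    and L: "1 \<le> L" and LN: "2 * L < N - 1" and K: "K = 1 / \<epsilon>\<^sup>2"
    and \<mu>: "\<mu> = bernoulli_product N \<rho>"
    and F: "F = (\<lambda>x y. jump \<gamma> (y - x) * I_exchange x y g \<mu>)"
    and B: "B = {int L + 1..2 * int L}"
  shows "(\<Sum>y = 1..int L. I_exchange y (y + int L) g \<mu> / real L powr \<gamma>)
    \<le> 9 * K\<^sup>2 * (2 powr (\<gamma> + 1) / c_norm \<gamma>)
        * ((\<Sum>y\<in>{1..int L}. \<Sum>z\<in>B. F y z) + (\<Sum>y\<in>B. \<Sum>z\<in>B. F y z))"
proof -
  let ?I = "\<lambda>x y. I_exchange x y g \<mu>"
  define c where "c = 2 powr (\<gamma> + 1) / c_norm \<gamma>"
  define P where "P = real L powr (- \<gamma> - 1)"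
  have cB: "card B = L" using B by simp
  have P: "1 / real L powr \<gamma> = real L * P" "0 \<le> P"
    using L by (simp_all add: P_def powr_minus powr_diff divide_simps)
  have rate: "P * ?I x z \<le> c * F x z" if "real_of_int \<bar>z - x\<bar> \<le> 2 * real L" for x z
  proof (cases "x = z")
    case True
    then show ?thesis by (simp add: F I_exchange_self jump_def)
  next
    case False
    then have "P \<le> c * jump \<gamma> (z - x)"
      unfolding P_def c_def using \<gamma> that by (intro jump_ge) auto
    from mult_right_mono[OF this I_exchange_nonneg[of x z g \<mu>]] show ?thesis
      by (simp add: F mult.assoc)
  qed
  have "?I y (y + int L) / real L powr \<gamma>
      \<le> 9 * K\<^sup>2 * c * ((\<Sum>z\<in>B. F y z) + (\<Sum>z\<in>B. F (y + int L) z))"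
    if y: "y \<in> {1..int L}" for y
  proof -
    \<comment> \<open>The averaging: \<open>B\<close> has \<open>L\<close> points, so the factor
      \<open>L\<close> in \<open>1 / real L powr \<gamma> = real L * P\<close> becomes a sum over
      \<open>z\<close>.\<close>
    have "?I y (y + int L) / real L powr \<gamma> = (\<Sum>z\<in>B. P * ?I y (y + int L))"
      using P(1) by (simp add: cB divide_inverse)
    also have "\<dots> \<le> (\<Sum>z\<in>B. 9 * K\<^sup>2 * c * (F y z + F (y + int L) z))"
    proof (rule sum_mono)
      fix z assume z: "z \<in> B"
      have "?I y (y + int L) \<le> 9 * K\<^sup>2 * (?I y z + ?I z (y + int L))"
        unfolding \<mu> using y z LN B by (intro I_exchange_triangle[OF \<epsilon> \<rho> _ _ _ K]) (auto simp: sites_def)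
      then have "P * ?I y (y + int L) \<le> P * (9 * K\<^sup>2 * (?I y z + ?I (y + int L) z))"
        using P(2) by (metis I_exchange_commute mult_left_mono)
      also have "\<dots> = 9 * K\<^sup>2 * (P * ?I y z + P * ?I (y + int L) z)"
        by (simp add: algebra_simps)
      \<comment> \<open>The points \<open>y\<close>, \<open>y + L\<close> and \<open>z\<close> all
        lie in \<open>{1..2 * L}\<close>, so both distances are within the range of
        \<open>rate\<close>.\<close>
      also have "\<dots> \<le> 9 * K\<^sup>2 * (c * F y z + c * F (y + int L) z)"
        using y z B by (intro mult_left_mono add_mono rate) auto
      finally show "P * ?I y (y + int L) \<le> 9 * K\<^sup>2 * c * (F y z + F (y + int L) z)"
        by (simp add: algebra_simps)
    qed
    finally show ?thesis
      by (simp add: sum_distrib_left[symmetric] sum.distrib)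
  qed
  then have "(\<Sum>y = 1..int L. ?I y (y + int L) / real L powr \<gamma>)
      \<le> (\<Sum>y\<in>{1..int L}. 9 * K\<^sup>2 * c * ((\<Sum>z\<in>B. F y z) + (\<Sum>z\<in>B. F (y + int L) z)))"
    by (rule sum_mono)
  also have "\<dots> = 9 * K\<^sup>2 * c * ((\<Sum>y\<in>{1..int L}. \<Sum>z\<in>B. F y z)
      + (\<Sum>y\<in>{1..int L}. \<Sum>z\<in>B. F (y + int L) z))"
    by (simp add: sum_distrib_left[symmetric] sum.distrib)
  \<comment> \<open>Translation by \<open>L\<close> carries \<open>{1..L}\<close> onto
    \<open>B\<close>, so these bonds are the ones inside the block.\<close>
  also have "(\<Sum>y\<in>{1..int L}. \<Sum>z\<in>B. F (y + int L) z) = (\<Sum>y\<in>B. \<Sum>z\<in>B. F y z)"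
    by (rule sum.reindex_bij_witness[of _ "\<lambda>y. y - int L" "\<lambda>y. y + int L"]) (auto simp: B)
  finally show ?thesis
    by (simp add: c_def)
qed

section \<open>Summation over the scales\<close>

theorem lemma5p8:
  fixes \<gamma> \<theta> \<kappa> \<alpha> \<beta> :: real and \<rho> :: "real \<Rightarrow> real"
  assumes "0 < \<gamma>" and "\<gamma> < 2"
    and "0 < \<kappa>"
    and "0 < \<alpha>" and "\<alpha> < 1"
    and "0 < \<beta>" and "\<beta> < 1"
    and "\<rho> \<in> {0..1} \<rightarrow> {0<..<1}"
    and "\<rho> 0 = \<alpha>" and "\<rho> 1 = \<beta>"
    and bounded_away: "\<exists>\<epsilon>>0. \<forall>u\<in>{0..1}. \<epsilon> \<le> \<rho> u \<and> \<rho> u \<le> 1 - \<epsilon>"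
  shows "\<exists>C>0. \<forall>(N::nat) (l0::nat) (M::nat) (f :: config \<Rightarrow> real).
    2 \<le> N \<longrightarrow> 1 \<le> l0 \<longrightarrow> l0 \<le> N - 1 \<longrightarrow> 1 \<le> M \<longrightarrow> dyadic l0 M < N - 1 \<longrightarrow>
    is_density N (bernoulli_product N \<rho>) f \<longrightarrow>
    (\<Sum>i = 1..M. \<Sum>y = 1..int (dyadic l0 (i - 1)).
        I_exchange y (y + int (dyadic l0 (i - 1))) (\<lambda>\<eta>. sqrt (f \<eta>)) (bernoulli_product N \<rho>)
          / real (dyadic l0 (i - 1)) powr \<gamma>)
      \<le> C * dirichlet \<gamma> \<theta> \<kappa> \<alpha> \<beta> N (\<lambda>\<eta>. sqrt (f \<eta>)) (bernoulli_product N \<rho>)"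
proof -
  obtain \<epsilon> where \<epsilon>: "0 < \<epsilon>" and \<rho>: "\<forall>u\<in>{0..1}. \<epsilon> \<le> \<rho> u \<and> \<rho> u \<le> 1 - \<epsilon>"
    using bounded_away by blast
  \<comment> \<open>The bound \<epsilon> comes from the profile \<rho> alone, so \<open>K\<close>
    and the final constant do not depend on \<open>N\<close>, \<open>l0\<close>, \<open>M\<close> or
    \<open>f\<close>.\<close>
  define K where "K = 1 / \<epsilon>\<^sup>2"
  define c where "c = 9 * K\<^sup>2 * (2 powr (\<gamma> + 1) / c_norm \<gamma>)"
  have c: "0 < c"
    using \<epsilon> c_norm_pos[OF \<open>0 < \<gamma>\<close>] by (simp add: c_def K_def)
  \<comment> \<open>There are two families of bonds, from \<open>{1..L}\<close> to the block and
    inside the block; each is bounded by the bulk sum, that is by twice the Dirichlet form, whence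
    the 4.\<close>
  show ?thesis
  proof (intro exI[of _ "4 * c"] conjI allI impI)
    show "0 < 4 * c" using c by simp
  next
    fix N l0 M :: nat and f :: "config \<Rightarrow> real"
    assume l0: "1 \<le> l0" and M: "dyadic l0 M < N - 1"
    define \<mu> where "\<mu> = bernoulli_product N \<rho>"
    define g where "g \<eta> = sqrt (f \<eta>)" for \<eta>
    define L where "L i = dyadic l0 (i - 1)" for i
    define A where "A i = {1..int (L i)}" for i
    define B where "B i = {int (L i) + 1..2 * int (L i)}" for i
    define F where "F x y = jump \<gamma> (y - x) * I_exchange x y g \<mu>" for x y
    have F: "0 \<le> F x y" for x y
      using \<open>0 < \<gamma>\<close> by (simp add: F_def I_exchange_nonneg jump_nonneg)
    have L: "1 \<le> L i" "2 * L i < N - 1" if "i \<in> {1..M}" for i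
    proof -
      show "1 \<le> L i" using l0 by (simp add: L_def dyadic_def)
      \<comment> \<open>\<open>2 * L i\<close> is \<open>dyadic l0 i\<close>, hence at most
        \<open>dyadic l0 M\<close>: the bound on the last scale keeps every block inside
        \<open>sites N\<close>.\<close>
      show "2 * L i < N - 1"
        using dyadic_mono[of i M l0] M that dyadic_Suc[of l0 "i - 1"] by (simp add: L_def)
    qed
    have sub: "A i \<subseteq> sites N" "B i \<subseteq> sites N" if "i \<in> {1..M}" for i
      using L[OF that] by (auto simp: A_def B_def sites_def)
    have disj: "disjoint_family_on B {1..M}"
      unfolding disjoint_family_on_def
    proof (intro ballI impI)
      fix i j assume "i \<in> {1..M}" "j \<in> {1..M}" "i \<noteq> j"
      \<comment> \<open>Indices start at 1, so truncated subtraction does not merge two of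
        them.\<close>
      then have "i - 1 \<noteq> j - 1" by auto
      then show "B i \<inter> B j = {}"
        using disjoint_dyadic_blocks[of l0] unfolding disjoint_family_on_def B_def L_def by blast
    qed
    have "(\<Sum>i = 1..M. \<Sum>y = 1..int (L i). I_exchange y (y + int (L i)) g \<mu> / real (L i) powr \<gamma>)
        \<le> (\<Sum>i = 1..M. c * ((\<Sum>y\<in>A i. \<Sum>z\<in>B i. F y z) + (\<Sum>y\<in>B i. \<Sum>z\<in>B i. F y z)))"
      unfolding c_def A_def
      by (rule sum_mono, rule scale_le[OF \<open>0 < \<gamma>\<close> \<epsilon> \<rho> _ _ K_def \<mu>_def _ B_def])
         (use L F_def in \<open>auto simp: fun_eq_iff\<close>)
    also have "\<dots> = c * ((\<Sum>i = 1..M. \<Sum>y\<in>A i. \<Sum>z\<in>B i. F y z)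
        + (\<Sum>i = 1..M. \<Sum>y\<in>B i. \<Sum>z\<in>B i. F y z))"
      by (simp add: sum_distrib_left[symmetric] sum.distrib)
    also have "\<dots> \<le> c * ((\<Sum>x\<in>sites N. \<Sum>y\<in>sites N. F x y)
        + (\<Sum>x\<in>sites N. \<Sum>y\<in>sites N. F x y))"
      using c sub disj F
      by (intro mult_left_mono add_mono sum_Sigma_disjoint_le) (auto simp: sites_def)
    also have "\<dots> \<le> c * (2 * dirichlet \<gamma> \<theta> \<kappa> \<alpha> \<beta> N g \<mu> + 2 * dirichlet \<gamma> \<theta> \<kappa> \<alpha> \<beta> N g \<mu>)"
      unfolding F_def using c assms by (intro mult_left_mono add_mono bulk_le_dirichlet) auto
    also have "\<dots> = 4 * c * dirichlet \<gamma> \<theta> \<kappa> \<alpha> \<beta> N g \<mu>"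
      by simp
    finally show "(\<Sum>i = 1..M. \<Sum>y = 1..int (dyadic l0 (i - 1)).
        I_exchange y (y + int (dyadic l0 (i - 1))) (\<lambda>\<eta>. sqrt (f \<eta>)) (bernoulli_product N \<rho>)
          / real (dyadic l0 (i - 1)) powr \<gamma>)
      \<le> 4 * c * dirichlet \<gamma> \<theta> \<kappa> \<alpha> \<beta> N (\<lambda>\<eta>. sqrt (f \<eta>)) (bernoulli_product N \<rho>)"
      by (simp only: L_def g_def[abs_def] \<mu>_def)
  qed
qed

end
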